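(* Let $\Omega\subset\mathbb{R}^D$ be a bounded domain with $|\Omega|>0$, let $d\ge 0$ be a fixed polynomial degree, and let $\omega\in L^\infty(\Omega)$ be the weight function. Assume that the matrices $\Phi$ and $P$ (defined in the context for $N$ distinct data points) have full rank, and assume that $$\|B\boldsymbol{\tau}(\cdot)\|_{\ell^1}\to 0\ \text{ in } L^1(\Omega)\quad\text{as } N\to\infty,$$ that is, $\int_\Omega\|B\boldsymbol{\tau}(\boldsymbol{x})\|_{\ell^1}\,\mathrm{d}\boldsymbol{x}\to 0$ as $N\to\infty$. Let $\hat{\mathbf{w}}$ be the vector of weights of the pure radial basis function (RBF) quadrature formula without polynomials, and $\mathbf{w}$ the vector of weights of the RBF quadrature formula augmented with polynomials up to degree $d$. Then the two following statements are equivalent: (a) $\|\hat{\mathbf{w}}\|_{\ell^1}\to\|I\|_\infty$ for $N\to\infty$; (b) $\|\mathbf{w}\|_{\ell^1}\to\|I\|_\infty$ for $N\to\infty$. That is, either both the pure and the polynomial augmented RBF quadrature formula are asymptotically stable or none is.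
   Context: $I[f]=\int_\Omega f(\boldsymbol{x})\,\omega(\boldsymbol{x})\,\mathrm{d}\boldsymbol{x}$ and $\|I\|_\infty=I[1]$. A sequence of quadrature formulas with weights $\mathbf{w}_N\in\mathbb{R}^N$, $N\in\mathbb{N}$, is called asymptotically stable if $\|\mathbf{w}_N\|_{\ell^1}\to\|I\|_\infty$ for $N\to\infty$. Let $\mathbf{x}_1,\dots,\mathbf{x}_N\in\Omega$ be distinct data points, $\varphi:\mathbb{R}_0^+\to\mathbb{R}$ the RBF (kernel), and $\varepsilon_1,\dots,\varepsilon_N$ nonnegative shape parameters (not necessarily equal). Let $\{p_k\}_{k=1}^K$ be a basis of the space of algebraic polynomials up to degree $d$ on $\Omega$ and $\mathbf{p}(\boldsymbol{x})=[p_1(\boldsymbol{x}),\dots,p_K(\boldsymbol{x})]^T$. Set $$\Phi=\big[\varphi(\varepsilon_j\|\mathbf{x}_i-\mathbf{x}_j\|_2)\big]_{i,j=1}^N,\qquad P=\big[p_k(\mathbf{x}_i)\big]_{i=1,\dots,N;\,k=1,\dots,K}.$$ $P$ having full rank means that the columns of $P$ are linearly independent. Augmented cardinal functions: $c_m(\boldsymbol{x})=\sum_{n=1}^N\alpha_n^{(m)}\varphi(\varepsilon_n\|\boldsymbol{x}-\mathbf{x}_n\|_2)+\sum_{k=1}^K\beta_k^{(m)}p_k(\boldsymbol{x})$, $m=1,\dots,N$, uniquely determined by $c_m(\mathbf{x}_n)=\delta_{mn}$ for all $n$ and $\sum_{n=1}^N\alpha_n^{(m)}p_k(\mathbf{x}_n)=0$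 for all $k$. Pure cardinal functions (no polynomials): $\hat c_m(\boldsymbol{x})=\sum_{n=1}^N\hat\alpha_n^{(m)}\varphi(\varepsilon_n\|\boldsymbol{x}-\mathbf{x}_n\|_2)$ with $\hat c_m(\mathbf{x}_n)=\delta_{mn}$ for all $n$; write $\hat{\mathbf{c}}=[\hat c_1,\dots,\hat c_N]^T$. The quadrature weights are $\mathbf{w}=[I[c_1],\dots,I[c_N]]^T$ and $\hat{\mathbf{w}}=[I[\hat c_1],\dots,I[\hat c_N]]^T$. Furthermore, $$B=\Phi^{-1}P\left(P^T\Phi^{-1}P\right)^{-1},\qquad \boldsymbol{\tau}(\boldsymbol{x})=P^T\hat{\mathbf{c}}(\boldsymbol{x})-\mathbf{p}(\boldsymbol{x}).$$ Here $B\boldsymbol{\tau}:\Omega\to\mathbb{R}^N$ is a vector-valued function, and $\|B\boldsymbol{\tau}(\boldsymbol{x})\|_{\ell^1}$ is the usual $\ell^1$-norm of the vector $B\boldsymbol{\tau}(\boldsymbol{x})\in\mathbb{R}^N$.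
   Formalization: B is taken as Φ^{-T}P(P^TΦ^{-T}P)^{-1}, which equals the stated B when Φ is symmetric (e.g. equal shape parameters); with unequal shape parameters the claim with the stated B is false. Integrability of the kernels against ω and unique solvability are explicit. *)

theory Defs
  imports
    "HOL-Analysis.Analysis"
    "Jordan_Normal_Form.DL_Rank"
    "Jordan_Normal_Form.Gauss_Jordan_Elimination"
begin

text \<open>
  Points of $\mathbb{R}^D$ have type \<open>real ^ 'D\<close>. Vectors and matrices whose size depends on the
  number of data points come from \<open>Jordan_Normal_Form\<close>; \<open>$\<close> denotes access to those. All indices
  start at 0, so the data points are \<open>X 0, \<dots>, X (N - 1)\<close> and the polynomial basis is
  \<open>p 0, \<dots>, p (K - 1)\<close>.
\<close>

unbundle no vec_syntax
hide_type (open) Finite_Cartesian_Product.vec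
hide_const (open) Finite_Cartesian_Product.vec Finite_Cartesian_Product.mat
  Determinants.det Cartesian_Space.rank Finite_Cartesian_Product.row
  Finite_Cartesian_Product.column Finite_Cartesian_Product.transpose

definition l1_norm :: "real vec \<Rightarrow> real" where
  "l1_norm v = (\<Sum>i<dim_vec v. \<bar>v $ i\<bar>)"

text \<open>Arbitrary (namely \<open>the None\<close>) on singular matrices.\<close>

definition mat_inv :: "real mat \<Rightarrow> real mat" where
  "mat_inv A = the (mat_inverse A)"


subsection \<open>Integration and asymptotic stability\<close>

definition L_infinity :: "(real ^ 'D) set \<Rightarrow> (real ^ 'D \<Rightarrow> real) \<Rightarrow> bool" where
  "L_infinity \<Omega> \<omega> \<longleftrightarrow>
     \<omega> \<in> borel_measurable (lebesgue_on \<Omega>) \<and> (\<exists>C. AE y in lebesgue_on \<Omega>. \<bar>\<omega> y\<bar> \<le> C)"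

definition weighted_integral ::
  "(real ^ 'D) set \<Rightarrow> (real ^ 'D \<Rightarrow> real) \<Rightarrow> (real ^ 'D \<Rightarrow> real) \<Rightarrow> real" where
  "weighted_integral \<Omega> \<omega> f = (LINT y|lebesgue_on \<Omega>. f y * \<omega> y)"

text \<open>$\|I\|_\infty = I[1]$.\<close>

definition asymptotically_stable ::
  "(real ^ 'D) set \<Rightarrow> (real ^ 'D \<Rightarrow> real) \<Rightarrow> (nat \<Rightarrow> real vec) \<Rightarrow> bool" where
  "asymptotically_stable \<Omega> \<omega> w \<longleftrightarrow>
     (\<lambda>N. l1_norm (w N)) \<longlonglongrightarrow> weighted_integral \<Omega> \<omega> (\<lambda>_. 1)"

definition tends_to_0_in_L1 :: "(real ^ 'D) set \<Rightarrow> (nat \<Rightarrow> real ^ 'D \<Rightarrow> real) \<Rightarrow> bool" where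
  "tends_to_0_in_L1 \<Omega> f \<longleftrightarrow>
     (\<forall>\<^sub>F N in sequentially. integrable (lebesgue_on \<Omega>) (f N)) \<and>
     (\<lambda>N. LINT y|lebesgue_on \<Omega>. \<bar>f N y\<bar>) \<longlonglongrightarrow> 0"


subsection \<open>Polynomials of bounded total degree\<close>

definition exponents :: "nat \<Rightarrow> ('D::finite \<Rightarrow> nat) set" where
  "exponents d = {e. (\<Sum>i\<in>UNIV. e i) \<le> d}"

lemma finite_exponents: "finite (exponents d :: ('D::finite \<Rightarrow> nat) set)"
proof (rule finite_subset)
  show "(exponents d :: ('D \<Rightarrow> nat) set) \<subseteq> (\<Pi>\<^sub>E i\<in>UNIV. {..d})"
  proof
    fix e :: "'D \<Rightarrow> nat"
    assume "e \<in> exponents d"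
    then have "e i \<le> d" for i
      using member_le_sum[of i UNIV e] by (simp add: exponents_def)
    then show "e \<in> (\<Pi>\<^sub>E i\<in>UNIV. {..d})"
      by auto
  qed
  show "finite (\<Pi>\<^sub>E i\<in>(UNIV :: 'D set). {..d})"
    by (rule finite_PiE) auto
qed

definition polys_upto :: "nat \<Rightarrow> (real ^ 'D \<Rightarrow> real) set" where
  "polys_upto d =
     {f. \<exists>c. f = (\<lambda>y. \<Sum>e\<in>exponents d. c e * (\<Prod>i\<in>UNIV. vec_nth y i ^ e i))}"

text \<open>
  \<open>p 0, \<dots>, p (K - 1)\<close> is a basis of the space of restrictions to \<open>\<Omega>\<close>, so only the values on \<open>\<Omega>\<close>
  matter.
\<close>

definition poly_basis_on ::
  "(real ^ 'D) set \<Rightarrow> nat \<Rightarrow> nat \<Rightarrow> (nat \<Rightarrow> real ^ 'D \<Rightarrow> real) \<Rightarrow> bool" where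
  "poly_basis_on \<Omega> d K p \<longleftrightarrow>
     (\<forall>k<K. \<exists>q\<in>polys_upto d. \<forall>y\<in>\<Omega>. p k y = q y) \<and>
     (\<forall>q\<in>polys_upto d. \<exists>a. \<forall>y\<in>\<Omega>. q y = (\<Sum>k<K. a k * p k y)) \<and>
     (\<forall>a. (\<forall>y\<in>\<Omega>. (\<Sum>k<K. a k * p k y) = 0) \<longrightarrow> (\<forall>k<K. a k = 0))"


subsection \<open>Cardinal functions and quadrature weights\<close>

text \<open>
  \<open>\<phi>\<close> is the kernel (only its values on the nonnegative reals are used), \<open>\<epsilon> n\<close> the shape parameter
  attached to the data point \<open>X n\<close>.
\<close>

definition rbf_mat ::
  "(real \<Rightarrow> real) \<Rightarrow> (nat \<Rightarrow> real) \<Rightarrow> (nat \<Rightarrow> real ^ 'D) \<Rightarrow> nat \<Rightarrow> real mat" where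
  "rbf_mat \<phi> \<epsilon> X N = mat N N (\<lambda>(i, j). \<phi> (\<epsilon> j * norm (X i - X j)))"

definition poly_mat ::
  "(nat \<Rightarrow> real ^ 'D \<Rightarrow> real) \<Rightarrow> nat \<Rightarrow> (nat \<Rightarrow> real ^ 'D) \<Rightarrow> nat \<Rightarrow> real mat" where
  "poly_mat p K X N = mat N K (\<lambda>(i, k). p k (X i))"

definition rbf_sum ::
  "(real \<Rightarrow> real) \<Rightarrow> (nat \<Rightarrow> real) \<Rightarrow> (nat \<Rightarrow> real ^ 'D) \<Rightarrow> nat \<Rightarrow> real vec \<Rightarrow> real ^ 'D \<Rightarrow> real" where
  "rbf_sum \<phi> \<epsilon> X N \<alpha> y = (\<Sum>n<N. \<alpha> $ n * \<phi> (\<epsilon> n * norm (y - X n)))"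

definition poly_sum ::
  "(nat \<Rightarrow> real ^ 'D \<Rightarrow> real) \<Rightarrow> nat \<Rightarrow> real vec \<Rightarrow> real ^ 'D \<Rightarrow> real" where
  "poly_sum p K \<beta> y = (\<Sum>k<K. \<beta> $ k * p k y)"

text \<open>
  The sets of admissible coefficients of the \<open>m\<close>-th cardinal function; the cardinal functions below
  are meaningful when these sets are singletons.
\<close>

definition pure_coeffs ::
  "(real \<Rightarrow> real) \<Rightarrow> (nat \<Rightarrow> real) \<Rightarrow> (nat \<Rightarrow> real ^ 'D) \<Rightarrow> nat \<Rightarrow> nat \<Rightarrow> real vec set" where
  "pure_coeffs \<phi> \<epsilon> X N m =
     {\<alpha> \<in> carrier_vec N. \<forall>n<N. rbf_sum \<phi> \<epsilon> X N \<alpha> (X n) = (if m = n then 1 else 0)}"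

definition aug_coeffs ::
  "(real \<Rightarrow> real) \<Rightarrow> (nat \<Rightarrow> real ^ 'D \<Rightarrow> real) \<Rightarrow> nat \<Rightarrow> (nat \<Rightarrow> real) \<Rightarrow> (nat \<Rightarrow> real ^ 'D) \<Rightarrow>
   nat \<Rightarrow> nat \<Rightarrow> (real vec \<times> real vec) set" where
  "aug_coeffs \<phi> p K \<epsilon> X N m =
     {(\<alpha>, \<beta>). \<alpha> \<in> carrier_vec N \<and> \<beta> \<in> carrier_vec K \<and>
        (\<forall>n<N. rbf_sum \<phi> \<epsilon> X N \<alpha> (X n) + poly_sum p K \<beta> (X n) = (if m = n then 1 else 0)) \<and>
        (\<forall>k<K. (\<Sum>n<N. \<alpha> $ n * p k (X n)) = 0)}"

definition pure_cardinal ::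
  "(real \<Rightarrow> real) \<Rightarrow> (nat \<Rightarrow> real) \<Rightarrow> (nat \<Rightarrow> real ^ 'D) \<Rightarrow> nat \<Rightarrow> nat \<Rightarrow> real ^ 'D \<Rightarrow> real" where
  "pure_cardinal \<phi> \<epsilon> X N m =
     (let \<alpha> = (THE \<alpha>. \<alpha> \<in> pure_coeffs \<phi> \<epsilon> X N m) in rbf_sum \<phi> \<epsilon> X N \<alpha>)"

definition aug_cardinal ::
  "(real \<Rightarrow> real) \<Rightarrow> (nat \<Rightarrow> real ^ 'D \<Rightarrow> real) \<Rightarrow> nat \<Rightarrow> (nat \<Rightarrow> real) \<Rightarrow> (nat \<Rightarrow> real ^ 'D) \<Rightarrow>
   nat \<Rightarrow> nat \<Rightarrow> real ^ 'D \<Rightarrow> real" where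
  "aug_cardinal \<phi> p K \<epsilon> X N m =
     (let (\<alpha>, \<beta>) = (THE s. s \<in> aug_coeffs \<phi> p K \<epsilon> X N m)
      in (\<lambda>y. rbf_sum \<phi> \<epsilon> X N \<alpha> y + poly_sum p K \<beta> y))"

definition pure_weights ::
  "(real ^ 'D) set \<Rightarrow> (real ^ 'D \<Rightarrow> real) \<Rightarrow> (real \<Rightarrow> real) \<Rightarrow> (nat \<Rightarrow> real) \<Rightarrow>
   (nat \<Rightarrow> real ^ 'D) \<Rightarrow> nat \<Rightarrow> real vec" where
  "pure_weights \<Omega> \<omega> \<phi> \<epsilon> X N =
     Matrix.vec N (\<lambda>m. weighted_integral \<Omega> \<omega> (pure_cardinal \<phi> \<epsilon> X N m))"

definition aug_weights ::
  "(real ^ 'D) set \<Rightarrow> (real ^ 'D \<Rightarrow> real) \<Rightarrow> (real \<Rightarrow> real) \<Rightarrow> (nat \<Rightarrow> real ^ 'D \<Rightarrow> real) \<Rightarrow> nat \<Rightarrow>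
   (nat \<Rightarrow> real) \<Rightarrow> (nat \<Rightarrow> real ^ 'D) \<Rightarrow> nat \<Rightarrow> real vec" where
  "aug_weights \<Omega> \<omega> \<phi> p K \<epsilon> X N =
     Matrix.vec N (\<lambda>m. weighted_integral \<Omega> \<omega> (aug_cardinal \<phi> p K \<epsilon> X N m))"


subsection \<open>The correction term\<close>

definition tau ::
  "(real \<Rightarrow> real) \<Rightarrow> (nat \<Rightarrow> real ^ 'D \<Rightarrow> real) \<Rightarrow> nat \<Rightarrow> (nat \<Rightarrow> real) \<Rightarrow> (nat \<Rightarrow> real ^ 'D) \<Rightarrow>
   nat \<Rightarrow> real ^ 'D \<Rightarrow> real vec" where
  "tau \<phi> p K \<epsilon> X N y =
     (poly_mat p K X N)\<^sup>T *\<^sub>v Matrix.vec N (\<lambda>m. pure_cardinal \<phi> \<epsilon> X N m y)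
       - Matrix.vec K (\<lambda>k. p k y)"

definition B_of :: "real mat \<Rightarrow> real mat \<Rightarrow> real mat" where
  "B_of A P = mat_inv A * P * mat_inv (P\<^sup>T * mat_inv A * P)"

text \<open>
  The role of $B$ is the identity $\mathbf{c} = \hat{\mathbf{c}} - B \tau$ between the augmented and
  the pure cardinal functions. Eliminating the coefficients from the augmented interpolation system
  gives this identity with $B = \Phi^{-T} P (P^T \Phi^{-T} P)^{-1}$. When the shape parameters
  are equal, $\Phi$ is symmetric and this is the usual
  $B = \Phi^{-1} P (P^T \Phi^{-1} P)^{-1}$; when they differ, $\Phi$ need not be
  symmetric and the transpose cannot be dropped.
\<close>

definition B_mat ::
  "(real \<Rightarrow> real) \<Rightarrow> (nat \<Rightarrow> real ^ 'D \<Rightarrow> real) \<Rightarrow> nat \<Rightarrow> (nat \<Rightarrow> real) \<Rightarrow> (nat \<Rightarrow> real ^ 'D) \<Rightarrow>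
   nat \<Rightarrow> real mat" where
  "B_mat \<phi> p K \<epsilon> X N = B_of ((rbf_mat \<phi> \<epsilon> X N)\<^sup>T) (poly_mat p K X N)"

lemma B_mat_symmetric:
  assumes "(rbf_mat \<phi> \<epsilon> X N)\<^sup>T = rbf_mat \<phi> \<epsilon> X N"
  shows "B_mat \<phi> p K \<epsilon> X N = B_of (rbf_mat \<phi> \<epsilon> X N) (poly_mat p K X N)"
  by (simp add: B_mat_def assms)

lemma B_mat_equal_shapes:
  assumes "\<And>i j. i < N \<Longrightarrow> j < N \<Longrightarrow> \<epsilon> i = \<epsilon> j"
  shows "B_mat \<phi> p K \<epsilon> X N = B_of (rbf_mat \<phi> \<epsilon> X N) (poly_mat p K X N)"
proof (rule B_mat_symmetric, rule eq_matI)
  fix i j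
  assume "i < dim_row (rbf_mat \<phi> \<epsilon> X N)" "j < dim_col (rbf_mat \<phi> \<epsilon> X N)"
  then have "i < N" "j < N"
    by (simp_all add: rbf_mat_def)
  with assms[of i j] show "(rbf_mat \<phi> \<epsilon> X N)\<^sup>T $$ (i, j) = rbf_mat \<phi> \<epsilon> X N $$ (i, j)"
    by (simp add: rbf_mat_def norm_minus_commute)
qed (simp_all add: rbf_mat_def)

end

theory Submission
  imports Defs
begin

text \<open>
  Write $\hat c$, $c$ for the vectors of pure and augmented cardinal functions and $B\tau$ for the
  correction term. The theorem says that \<open>B\<tau> \<rightarrow> 0\<close> in $L^1$ makes the two weight vectors
  asymptotically equal in $\ell^1$, and the reason is the exact identity
  $c = \hat c - B\tau$, valid at every point (\<open>aug_cardinal_eq_pure_minus_correction\<close>).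

  This identity is linear algebra. Let $A = \Phi^T$, let $f(y)$ be the vector of kernel values
  at $y$, and collect the coefficients of the augmented cardinal functions in the rows of
  matrices $M$ and $C$. The defining equations read $MA + CP^T = 1$ and $MP = 0$, and
  $c = Mf + Cp$, whereas $\hat c = A^{-1}f$. Substituting $f = A\hat c$ and
  $MA = 1 - CP^T$ gives $c = \hat c - C(P^T\hat c - p) = \hat c - C\tau$. Multiplying the first
  equation by $A^{-1}P$ from the right eliminates $M$ and leaves
  $C\,(P^TA^{-1}P) = A^{-1}P$, that is, $C = B$
  (\<open>saddle_point_coefficients_eq_B_of\<close>).

  Integrated against \<open>\<omega>\<close>, the identity bounds the $\ell^1$-distance of the two weight vectors by
  an essential bound of \<open>\<omega>\<close> times the $L^1$-norm of $\|B\tau\|_{\ell^1}$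
  (\<open>weights_distance_le\<close>). Hence the distance tends to 0, and one of the two $\ell^1$-norms
  converges to $I[1]$ if and only if the other one does.
\<close>

section \<open>The elimination of the coefficients\<close>

lemma mat_inv_inverts:
  assumes "A \<in> carrier_mat n n" and "Determinant.det A \<noteq> 0"
  shows "mat_inv A \<in> carrier_mat n n" and "A * mat_inv A = 1\<^sub>m n" and "mat_inv A * A = 1\<^sub>m n"
proof -
  have "A \<in> Units (ring_mat TYPE(real) n ())"
    using det_non_zero_imp_unit[OF assms] .
  then obtain G where G: "mat_inverse A = Some G"
    using mat_inverse(1)[OF assms(1), of "()"] by fastforce
  with mat_inverse(2)[OF assms(1) this]
  show "mat_inv A \<in> carrier_mat n n" "A * mat_inv A = 1\<^sub>m n" "mat_inv A * A = 1\<^sub>m n"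
    by (auto simp: mat_inv_def)
qed

text \<open>
  Multiplication of the first equation by $A^{-1}P$ kills $M$ because $MP = 0$, which
  leaves $C\,(P^TA^{-1}P) = A^{-1}P$. The same equation shows that the Schur complement
  $P^TA^{-1}P$ is invertible: its kernel is contained in that of $A^{-1}P$, hence in that
  of $P$.
\<close>

lemma saddle_point_coefficients_eq_B_of:
  fixes A P M C :: "real mat"
  assumes A: "A \<in> carrier_mat N N" and detA: "Determinant.det A \<noteq> 0"
    and P: "P \<in> carrier_mat N K" and M: "M \<in> carrier_mat N N" and C: "C \<in> carrier_mat N K"
    and interpolation: "M * A + C * P\<^sup>T = 1\<^sub>m N" and orthogonality: "M * P = 0\<^sub>m N K"
    and inj: "\<And>v. v \<in> carrier_vec K \<Longrightarrow> P *\<^sub>v v = 0\<^sub>v N \<Longrightarrow> v = 0\<^sub>v K"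
  shows "C = B_of A P"
proof -
  define G where "G = mat_inv A"
  have G: "G \<in> carrier_mat N N" and AG: "A * G = 1\<^sub>m N"
    using mat_inv_inverts[OF A detA] by (auto simp: G_def)
  define S where "S = P\<^sup>T * G * P"
  have PT: "P\<^sup>T \<in> carrier_mat K N"
    using P by simp
  have GP: "G * P \<in> carrier_mat N K"
    using G P by simp
  have S: "S \<in> carrier_mat K K"
    using G P by (simp add: S_def)
  have S_eq: "S = P\<^sup>T * (G * P)"
    unfolding S_def by (rule assoc_mult_mat[OF PT G P])
  have AGP: "A * (G * P) = P"
    using left_mult_one_mat[OF P] by (simp only: AG flip: assoc_mult_mat[OF A G P])
  have "G * P = (M * A + C * P\<^sup>T) * (G * P)"
    using left_mult_one_mat[OF GP] by (simp add: interpolation)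
  also have "\<dots> = M * A * (G * P) + C * P\<^sup>T * (G * P)"
    using add_mult_distrib_mat[OF mult_carrier_mat[OF M A] mult_carrier_mat[OF C PT] GP] .
  also have "M * A * (G * P) = 0\<^sub>m N K"
    by (simp only: assoc_mult_mat[OF M A GP] AGP orthogonality)
  also have "C * P\<^sup>T * (G * P) = C * S"
    by (simp only: assoc_mult_mat[OF C PT GP] S_eq)
  finally have CS: "C * S = G * P"
    using C S by simp
  have "v = 0\<^sub>v K" if v: "v \<in> carrier_vec K" and Sv: "S *\<^sub>v v = 0\<^sub>v K" for v
  proof (rule inj[OF v])
    have "(G * P) *\<^sub>v v = C *\<^sub>v (S *\<^sub>v v)"
      using CS assoc_mult_mat_vec[OF C S v] by simp
    also have "\<dots> = 0\<^sub>v N"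
      using C unfolding Sv by (intro eq_vecI) (auto simp: scalar_prod_def)
    finally have "A *\<^sub>v ((G * P) *\<^sub>v v) = 0\<^sub>v N"
      using A by (intro eq_vecI) (auto simp: scalar_prod_def)
    then show "P *\<^sub>v v = 0\<^sub>v N"
      using assoc_mult_mat_vec[OF A GP v] AGP by simp
  qed
  then have "Determinant.det S \<noteq> 0"
    using det_0_iff_vec_prod_zero_field[OF S] by blast
  note S_inv = mat_inv_inverts[OF S this]
  have "C = C * (S * mat_inv S)"
    using C S_inv(2) by simp
  also have "\<dots> = G * P * mat_inv S"
    using assoc_mult_mat[OF C S S_inv(1)] CS by simp
  finally show ?thesis
    by (simp add: B_of_def G_def S_def)
qed

text \<open>
  In the application, \<open>f\<close> and \<open>q\<close> hold the values of the kernels and of the polynomials at one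
  point, and $A^{-1}f$ those of the pure cardinal functions.
\<close>

lemma saddle_point_solution_eq:
  fixes A P M C :: "real mat"
  assumes A: "A \<in> carrier_mat N N" and detA: "Determinant.det A \<noteq> 0"
    and P: "P \<in> carrier_mat N K" and M: "M \<in> carrier_mat N N" and C: "C \<in> carrier_mat N K"
    and interpolation: "M * A + C * P\<^sup>T = 1\<^sub>m N" and orthogonality: "M * P = 0\<^sub>m N K"
    and inj: "\<And>v. v \<in> carrier_vec K \<Longrightarrow> P *\<^sub>v v = 0\<^sub>v N \<Longrightarrow> v = 0\<^sub>v K"
    and f: "f \<in> carrier_vec N" and q: "q \<in> carrier_vec K"
  shows "M *\<^sub>v f + C *\<^sub>v q =
    mat_inv A *\<^sub>v f - B_of A P *\<^sub>v (P\<^sup>T *\<^sub>v (mat_inv A *\<^sub>v f) - q)"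
proof -
  define g where "g = mat_inv A *\<^sub>v f"
  have g: "g \<in> carrier_vec N"
    using mat_inv_inverts(1)[OF A detA] f by (simp add: g_def)
  have PT: "P\<^sup>T \<in> carrier_mat K N"
    using P by simp
  have PTg: "P\<^sup>T *\<^sub>v g \<in> carrier_vec K"
    using PT g by simp
  have "A *\<^sub>v g = f"
    using assoc_mult_mat_vec[OF A mat_inv_inverts(1)[OF A detA] f]
      mat_inv_inverts(2)[OF A detA] f by (simp add: g_def)
  then have Mf: "M *\<^sub>v f = (M * A) *\<^sub>v g"
    using assoc_mult_mat_vec[OF M A g] by simp
  have "(M * A) *\<^sub>v g + C *\<^sub>v (P\<^sup>T *\<^sub>v g) = (M * A + C * P\<^sup>T) *\<^sub>v g"
    using M A C PT g by (subst add_mult_distrib_mat_vec[where nr = N and nc = N]) auto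
  also have "\<dots> = g"
    using g by (simp add: interpolation)
  finally have "M *\<^sub>v f = g - C *\<^sub>v (P\<^sup>T *\<^sub>v g)"
    using Mf M f C PTg g by (auto simp: vec_eq_iff)
  moreover have "C *\<^sub>v (P\<^sup>T *\<^sub>v g - q) = C *\<^sub>v (P\<^sup>T *\<^sub>v g) - C *\<^sub>v q"
    by (rule mult_minus_distrib_mat_vec[OF C PTg q])
  ultimately have "M *\<^sub>v f + C *\<^sub>v q = g - C *\<^sub>v (P\<^sup>T *\<^sub>v g - q)"
    using C PTg q g by (auto simp: vec_eq_iff)
  then show ?thesis
    using saddle_point_coefficients_eq_B_of[OF A detA P M C interpolation orthogonality inj]
    by (simp add: g_def)
qed


section \<open>Pure and augmented cardinal functions\<close>

definition rbf_vec ::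
  "(real \<Rightarrow> real) \<Rightarrow> (nat \<Rightarrow> real) \<Rightarrow> (nat \<Rightarrow> real ^ 'D) \<Rightarrow> nat \<Rightarrow> real ^ 'D \<Rightarrow> real vec" where
  "rbf_vec \<phi> \<epsilon> X N y = Matrix.vec N (\<lambda>n. \<phi> (\<epsilon> n * norm (y - X n)))"

lemma rbf_mat_transpose_carrier: "(rbf_mat \<phi> \<epsilon> X N)\<^sup>T \<in> carrier_mat N N"
  by (simp add: rbf_mat_def)

text \<open>
  With $A = \Phi^T$, the interpolation conditions read $A^T\alpha = e_m$, so \<open>\<alpha>\<close> is the \<open>m\<close>-th
  column of $A^{-T}$, that is, the \<open>m\<close>-th row of $A^{-1}$.
\<close>

lemma pure_coeffs_eq:
  assumes "Determinant.det ((rbf_mat \<phi> \<epsilon> X N)\<^sup>T) \<noteq> 0" and m: "m < N"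
  shows "pure_coeffs \<phi> \<epsilon> X N m = {row (mat_inv ((rbf_mat \<phi> \<epsilon> X N)\<^sup>T)) m}"
proof -
  define A where "A = (rbf_mat \<phi> \<epsilon> X N)\<^sup>T"
  have A: "A \<in> carrier_mat N N"
    unfolding A_def by (rule rbf_mat_transpose_carrier)
  define G where "G = mat_inv A"
  have G: "G \<in> carrier_mat N N" and AG: "A * G = 1\<^sub>m N" and GA: "G * A = 1\<^sub>m N"
    using mat_inv_inverts[OF A] assms(1) by (auto simp: G_def A_def)
  have AT: "A\<^sup>T \<in> carrier_mat N N" and GT: "G\<^sup>T \<in> carrier_mat N N"
    using A G by auto
  have GTAT: "G\<^sup>T * A\<^sup>T = 1\<^sub>m N" and ATGT: "A\<^sup>T * G\<^sup>T = 1\<^sub>m N"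
    using AG GA by (simp_all flip: transpose_mult[OF A G] transpose_mult[OF G A])
  have interp: "(\<forall>n<N. rbf_sum \<phi> \<epsilon> X N \<alpha> (X n) = (if m = n then 1 else 0))
      \<longleftrightarrow> A\<^sup>T *\<^sub>v \<alpha> = unit_vec N m" if \<alpha>: "\<alpha> \<in> carrier_vec N" for \<alpha>
  proof -
    have "(A\<^sup>T *\<^sub>v \<alpha>) $ n = rbf_sum \<phi> \<epsilon> X N \<alpha> (X n)" if "n < N" for n
      using that \<alpha>
      by (auto simp: A_def rbf_mat_def rbf_sum_def scalar_prod_def mult.commute
          lessThan_atLeast0 intro!: sum.cong)
    then show ?thesis
      using A m by (auto simp: vec_eq_iff)
  qed
  have row: "row G m = G\<^sup>T *\<^sub>v unit_vec N m"
    using G m by (auto simp: vec_eq_iff scalar_prod_right_unit)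
  have "A\<^sup>T *\<^sub>v \<alpha> = unit_vec N m \<longleftrightarrow> \<alpha> = row G m" if \<alpha>: "\<alpha> \<in> carrier_vec N" for \<alpha>
  proof
    assume "A\<^sup>T *\<^sub>v \<alpha> = unit_vec N m"
    then show "\<alpha> = row G m"
      using assoc_mult_mat_vec[OF GT AT \<alpha>] GTAT \<alpha> row by simp
  next
    assume "\<alpha> = row G m"
    then show "A\<^sup>T *\<^sub>v \<alpha> = unit_vec N m"
      using assoc_mult_mat_vec[OF AT GT unit_vec_carrier] ATGT row by simp
  qed
  moreover have "row G m \<in> carrier_vec N"
    using G m by (intro carrier_vecI) simp
  ultimately show ?thesis
    using interp unfolding pure_coeffs_def G_def A_def by blast
qed

lemma pure_cardinal_eq:
  assumes "Determinant.det ((rbf_mat \<phi> \<epsilon> X N)\<^sup>T) \<noteq> 0" and "m < N"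
  shows "pure_cardinal \<phi> \<epsilon> X N m y = (mat_inv ((rbf_mat \<phi> \<epsilon> X N)\<^sup>T) *\<^sub>v rbf_vec \<phi> \<epsilon> X N y) $ m"
  using mat_inv_inverts(1)[OF rbf_mat_transpose_carrier assms(1)] assms(2)
  by (simp add: pure_cardinal_def pure_coeffs_eq[OF assms] rbf_sum_def rbf_vec_def
      scalar_prod_def lessThan_atLeast0)

text \<open>
  A vector in the kernel of $P$ could be added to the polynomial coefficients of any
  cardinal function, so uniqueness of these coefficients for a single index forces the kernel to
  be trivial.
\<close>

lemma poly_mat_injective:
  assumes unique: "\<exists>!s. s \<in> aug_coeffs \<phi> p K \<epsilon> X N m"
    and v: "v \<in> carrier_vec K" and Pv: "poly_mat p K X N *\<^sub>v v = 0\<^sub>v N"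
  shows "v = 0\<^sub>v K"
proof -
  obtain \<alpha> \<beta> where s: "(\<alpha>, \<beta>) \<in> aug_coeffs \<phi> p K \<epsilon> X N m"
    using unique by auto
  then have \<beta>: "\<beta> \<in> carrier_vec K"
    by (simp add: aug_coeffs_def)
  have "poly_sum p K v (X n) = 0" if "n < N" for n
  proof -
    have "(poly_mat p K X N *\<^sub>v v) $ n = poly_sum p K v (X n)"
      using that v by (auto simp: poly_mat_def poly_sum_def scalar_prod_def mult.commute
          lessThan_atLeast0 intro!: sum.cong)
    then show ?thesis
      using Pv that by simp
  qed
  moreover have "poly_sum p K (\<beta> + v) y = poly_sum p K \<beta> y + poly_sum p K v y" for y
    using \<beta> v by (simp add: poly_sum_def sum.distrib distrib_right)
  ultimately have "(\<alpha>, \<beta> + v) \<in> aug_coeffs \<phi> p K \<epsilon> X N m"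
    using s v by (auto simp: aug_coeffs_def)
  with unique s have "\<beta> + v = \<beta>"
    by blast
  then show ?thesis
    using \<beta> v by (auto simp: vec_eq_iff)
qed

text \<open>
  The identity $c = \hat c - B\tau$. It holds at all points of the space, not only at those of the
  domain of integration. The dimensions of $B$ rest on the invertibility of
  $P^T\Phi^{-T}P$ and therefore come out of the same argument.
\<close>

lemma aug_cardinal_eq_pure_minus_correction:
  assumes det: "Determinant.det ((rbf_mat \<phi> \<epsilon> X N)\<^sup>T) \<noteq> 0"
    and unique: "\<And>m. m < N \<Longrightarrow> \<exists>!s. s \<in> aug_coeffs \<phi> p K \<epsilon> X N m"
    and m: "m < N"
  shows "aug_cardinal \<phi> p K \<epsilon> X N m y =
    pure_cardinal \<phi> \<epsilon> X N m y - (B_mat \<phi> p K \<epsilon> X N *\<^sub>v tau \<phi> p K \<epsilon> X N y) $ m"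
    and "B_mat \<phi> p K \<epsilon> X N \<in> carrier_mat N K"
proof -
  define A where "A = (rbf_mat \<phi> \<epsilon> X N)\<^sup>T"
  define P where "P = poly_mat p K X N"
  define s where "s m = (THE s. s \<in> aug_coeffs \<phi> p K \<epsilon> X N m)" for m
  define M where "M = mat N N (\<lambda>(m, n). fst (s m) $ n)"
  define C where "C = mat N K (\<lambda>(m, k). snd (s m) $ k)"
  define f where "f = rbf_vec \<phi> \<epsilon> X N y"
  define q where "q = Matrix.vec K (\<lambda>k. p k y)"
  have A: "A \<in> carrier_mat N N" and P: "P \<in> carrier_mat N K"
    and M: "M \<in> carrier_mat N N" and C: "C \<in> carrier_mat N K"
    and f: "f \<in> carrier_vec N" and q: "q \<in> carrier_vec K"
    by (simp_all add: A_def P_def M_def C_def f_def q_def rbf_vec_def rbf_mat_def poly_mat_def)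
  have detA: "Determinant.det A \<noteq> 0"
    using det by (simp add: A_def)
  have s: "s i \<in> aug_coeffs \<phi> p K \<epsilon> X N i" if "i < N" for i
    unfolding s_def using unique[OF that] by (rule theI')
  have MA: "(M * A) $$ (i, n) = rbf_sum \<phi> \<epsilon> X N (fst (s i)) (X n)" if "i < N" "n < N" for i n
    using that by (simp add: M_def A_def rbf_mat_def rbf_sum_def scalar_prod_def lessThan_atLeast0)
  have CP: "(C * P\<^sup>T) $$ (i, n) = poly_sum p K (snd (s i)) (X n)" if "i < N" "n < N" for i n
    using that by (simp add: C_def P_def poly_mat_def poly_sum_def scalar_prod_def lessThan_atLeast0)
  have MP: "(M * P) $$ (i, k) = (\<Sum>n<N. fst (s i) $ n * p k (X n))" if "i < N" "k < K" for i k
    using that by (simp add: M_def P_def poly_mat_def scalar_prod_def lessThan_atLeast0)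
  have interpolation: "M * A + C * P\<^sup>T = 1\<^sub>m N"
  proof (rule eq_matI)
    fix i n assume "i < dim_row (1\<^sub>m N :: real mat)" "n < dim_col (1\<^sub>m N :: real mat)"
    then have "i < N" "n < N"
      by auto
    then show "(M * A + C * P\<^sup>T) $$ (i, n) = 1\<^sub>m N $$ (i, n)"
      using s[OF \<open>i < N\<close>] MA[of i n] CP[of i n] M A C P
      by (auto simp: aug_coeffs_def split: prod.splits simp del: index_mult_mat(1))
  qed (use M A C P in auto)
  have orthogonality: "M * P = 0\<^sub>m N K"
  proof (rule eq_matI)
    fix i k assume "i < dim_row (0\<^sub>m N K :: real mat)" "k < dim_col (0\<^sub>m N K :: real mat)"
    then have "i < N" "k < K"
      by auto
    then show "(M * P) $$ (i, k) = 0\<^sub>m N K $$ (i, k)"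
      using s[OF \<open>i < N\<close>] MP[of i k] by (auto simp: aug_coeffs_def simp del: index_mult_mat(1))
  qed (use M P in auto)
  have inj: "v = 0\<^sub>v K" if "v \<in> carrier_vec K" "P *\<^sub>v v = 0\<^sub>v N" for v
    using poly_mat_injective[OF unique[OF m]] that by (simp add: P_def)
  have B: "B_mat \<phi> p K \<epsilon> X N = B_of A P"
    by (simp add: B_mat_def A_def P_def)
  also have "\<dots> = C"
    using saddle_point_coefficients_eq_B_of[OF A detA P M C interpolation orthogonality inj] ..
  finally have BC: "B_mat \<phi> p K \<epsilon> X N = C" .
  then show "B_mat \<phi> p K \<epsilon> X N \<in> carrier_mat N K"
    using C by simp
  have pure: "mat_inv A *\<^sub>v f = Matrix.vec N (\<lambda>m. pure_cardinal \<phi> \<epsilon> X N m y)"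
    using pure_cardinal_eq[OF det] mat_inv_inverts(1)[OF A detA]
    by (auto simp: vec_eq_iff A_def f_def)
  have tau: "tau \<phi> p K \<epsilon> X N y = P\<^sup>T *\<^sub>v (mat_inv A *\<^sub>v f) - q"
    by (simp only: tau_def pure P_def q_def)
  have "aug_cardinal \<phi> p K \<epsilon> X N m y = (M *\<^sub>v f + C *\<^sub>v q) $ m"
    using m M C f q
    by (simp add: aug_cardinal_def Let_def s_def[symmetric] case_prod_unfold rbf_sum_def poly_sum_def
        M_def C_def f_def q_def rbf_vec_def scalar_prod_def lessThan_atLeast0)
  also have "\<dots> = (mat_inv A *\<^sub>v f - B_mat \<phi> p K \<epsilon> X N *\<^sub>v tau \<phi> p K \<epsilon> X N y) $ m"
    by (simp only: tau B
        saddle_point_solution_eq[OF A detA P M C interpolation orthogonality inj f q])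
  also have "\<dots> = (mat_inv A *\<^sub>v f) $ m - (B_mat \<phi> p K \<epsilon> X N *\<^sub>v tau \<phi> p K \<epsilon> X N y) $ m"
    by (rule index_minus_vec(1)) (use m C in \<open>simp add: BC\<close>)
  finally show "aug_cardinal \<phi> p K \<epsilon> X N m y =
      pure_cardinal \<phi> \<epsilon> X N m y - (B_mat \<phi> p K \<epsilon> X N *\<^sub>v tau \<phi> p K \<epsilon> X N y) $ m"
    using m by (simp add: pure)
qed


section \<open>The distance between the weights\<close>

lemma poly_measurable_lebesgue_on:
  assumes "\<Omega> \<in> sets lebesgue" and q: "q \<in> polys_upto d"
  shows "q \<in> borel_measurable (lebesgue_on \<Omega>)"
proof -
  have "continuous_on UNIV q"
    using q by (auto simp: polys_upto_def intro!: continuous_intros)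
  then show ?thesis
    using assms(1) continuous_imp_measurable_on_sets_lebesgue continuous_on_subset by blast
qed

lemma poly_basis_measurable:
  assumes "\<Omega> \<in> sets lebesgue" and "poly_basis_on \<Omega> d K p" and "k < K"
  shows "p k \<in> borel_measurable (lebesgue_on \<Omega>)"
proof -
  obtain q where q: "q \<in> polys_upto d" "\<And>y. y \<in> \<Omega> \<Longrightarrow> p k y = q y"
    using assms(2,3) by (auto simp: poly_basis_on_def)
  then have "p k \<in> borel_measurable (lebesgue_on \<Omega>) \<longleftrightarrow> q \<in> borel_measurable (lebesgue_on \<Omega>)"
    by (intro measurable_cong) simp
  then show ?thesis
    using poly_measurable_lebesgue_on[OF assms(1) q(1)] by simp
qed

lemma pure_cardinal_integrable:
  assumes "\<And>n. n < N \<Longrightarrow>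
      integrable (lebesgue_on \<Omega>) (\<lambda>y. \<phi> (\<epsilon> n * norm (y - X n)) * \<omega> y)"
  shows "integrable (lebesgue_on \<Omega>) (\<lambda>y. pure_cardinal \<phi> \<epsilon> X N m y * \<omega> y)"
proof -
  define \<alpha> where "\<alpha> = (THE \<alpha>. \<alpha> \<in> pure_coeffs \<phi> \<epsilon> X N m)"
  have "(\<lambda>y. pure_cardinal \<phi> \<epsilon> X N m y * \<omega> y) =
      (\<lambda>y. \<Sum>n<N. \<alpha> $ n * (\<phi> (\<epsilon> n * norm (y - X n)) * \<omega> y))"
    by (simp add: pure_cardinal_def \<alpha>_def[symmetric] rbf_sum_def sum_distrib_right mult.assoc)
  then show ?thesis
    using assms by (auto intro!: Bochner_Integration.integrable_sum)
qed

text \<open>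
  The integrability of the moments makes the products of the kernels with the weight measurable,
  but says nothing about the kernels where the weight vanishes. For this reason the weight
  has to be multiplied into the correction term and distributed over its kernel and polynomial
  parts.
\<close>

lemma correction_measurable:
  assumes \<Omega>: "\<Omega> \<in> sets lebesgue" and basis: "poly_basis_on \<Omega> d K p"
    and \<omega>: "\<omega> \<in> borel_measurable (lebesgue_on \<Omega>)"
    and moments: "\<And>n. n < N \<Longrightarrow>
      integrable (lebesgue_on \<Omega>) (\<lambda>y. \<phi> (\<epsilon> n * norm (y - X n)) * \<omega> y)"
    and Q: "Q \<in> carrier_mat N K" and m: "m < N"
  shows "(\<lambda>y. (Q *\<^sub>v tau \<phi> p K \<epsilon> X N y) $ m * \<omega> y) \<in> borel_measurable (lebesgue_on \<Omega>)"
proof -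
  have "(Q *\<^sub>v tau \<phi> p K \<epsilon> X N y) $ m * \<omega> y =
      (\<Sum>k<K. Q $$ (m, k) *
        ((\<Sum>n<N. p k (X n) * (pure_cardinal \<phi> \<epsilon> X N n y * \<omega> y)) - p k y * \<omega> y))" for y
    using Q m
    by (simp add: tau_def poly_mat_def scalar_prod_def lessThan_atLeast0 sum_distrib_right
        left_diff_distrib mult.assoc)
  moreover have "(\<lambda>y. pure_cardinal \<phi> \<epsilon> X N n y * \<omega> y) \<in> borel_measurable (lebesgue_on \<Omega>)" for n
    using pure_cardinal_integrable[where X = X and \<epsilon> = \<epsilon>, OF moments]
    by (rule borel_measurable_integrable)
  moreover note poly_basis_measurable[OF \<Omega> basis] \<omega>
  ultimately show ?thesis
    by simp
qed

lemma l1_norm_diff_le: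
  assumes "dim_vec v = dim_vec w"
  shows "\<bar>l1_norm v - l1_norm w\<bar> \<le> l1_norm (v - w)"
proof -
  have "\<bar>l1_norm v - l1_norm w\<bar> = \<bar>\<Sum>i<dim_vec w. \<bar>v $ i\<bar> - \<bar>w $ i\<bar>\<bar>"
    using assms by (simp add: l1_norm_def sum_subtractf)
  also have "\<dots> \<le> (\<Sum>i<dim_vec w. \<bar>\<bar>v $ i\<bar> - \<bar>w $ i\<bar>\<bar>)"
    by (rule sum_abs)
  also have "\<dots> \<le> (\<Sum>i<dim_vec w. \<bar>v $ i - w $ i\<bar>)"
    by (intro sum_mono) simp
  also have "\<dots> = l1_norm (v - w)"
    by (simp add: l1_norm_def)
  finally show ?thesis .
qed

text \<open>
  Almost everywhere, the components of $B\tau\,\omega$ are dominated together by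
  $C\,\|B\tau\|_{\ell^1}$. This makes the integral of each of them, which is the difference of
  two corresponding weights, converge, and bounds the sum of their absolute values.
\<close>

lemma weights_distance_le:
  assumes \<Omega>: "\<Omega> \<in> sets lebesgue" and basis: "poly_basis_on \<Omega> d K p"
    and \<omega>: "\<omega> \<in> borel_measurable (lebesgue_on \<Omega>)"
    and bound: "AE y in lebesgue_on \<Omega>. \<bar>\<omega> y\<bar> \<le> C"
    and moments: "\<And>n. n < N \<Longrightarrow>
      integrable (lebesgue_on \<Omega>) (\<lambda>y. \<phi> (\<epsilon> n * norm (y - X n)) * \<omega> y)"
    and det: "Determinant.det ((rbf_mat \<phi> \<epsilon> X N)\<^sup>T) \<noteq> 0"
    and unique: "\<And>m. m < N \<Longrightarrow> \<exists>!s. s \<in> aug_coeffs \<phi> p K \<epsilon> X N m"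
    and B_tau: "integrable (lebesgue_on \<Omega>)
      (\<lambda>y. l1_norm (B_mat \<phi> p K \<epsilon> X N *\<^sub>v tau \<phi> p K \<epsilon> X N y))"
  shows "\<bar>l1_norm (pure_weights \<Omega> \<omega> \<phi> \<epsilon> X N) - l1_norm (aug_weights \<Omega> \<omega> \<phi> p K \<epsilon> X N)\<bar> \<le>
    C * (LINT y|lebesgue_on \<Omega>. l1_norm (B_mat \<phi> p K \<epsilon> X N *\<^sub>v tau \<phi> p K \<epsilon> X N y))"
proof -
  define r where "r m y = (B_mat \<phi> p K \<epsilon> X N *\<^sub>v tau \<phi> p K \<epsilon> X N y) $ m" for m y
  define L where "L y = l1_norm (B_mat \<phi> p K \<epsilon> X N *\<^sub>v tau \<phi> p K \<epsilon> X N y)" for y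
  have rows: "dim_row (B_mat \<phi> p K \<epsilon> X N) = N"
    using mat_inv_inverts(1)[OF rbf_mat_transpose_carrier det] by (simp add: B_mat_def B_of_def)
  have L_eq: "L y = (\<Sum>m<N. \<bar>r m y\<bar>)" for y
    by (simp add: L_def l1_norm_def r_def rows)
  have dominated: "AE y in lebesgue_on \<Omega>. (\<Sum>m<N. \<bar>r m y * \<omega> y\<bar>) \<le> C * L y"
    using bound
  proof eventually_elim
    case (elim y)
    have "(\<Sum>m<N. \<bar>r m y * \<omega> y\<bar>) = L y * \<bar>\<omega> y\<bar>"
      by (simp add: L_eq abs_mult sum_distrib_right)
    also have "\<dots> \<le> L y * C"
      using elim by (intro mult_left_mono) (simp_all add: L_eq sum_nonneg)
    finally show ?case
      by (simp add: mult.commute)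
  qed
  have CL: "integrable (lebesgue_on \<Omega>) (\<lambda>y. C * L y)"
    using B_tau by (simp add: L_def)
  have r\<omega>: "integrable (lebesgue_on \<Omega>) (\<lambda>y. r m y * \<omega> y)" if m: "m < N" for m
  proof (rule Bochner_Integration.integrable_bound[OF CL])
    have "B_mat \<phi> p K \<epsilon> X N \<in> carrier_mat N K"
      using aug_cardinal_eq_pure_minus_correction(2)[OF det unique m] .
    then show "(\<lambda>y. r m y * \<omega> y) \<in> borel_measurable (lebesgue_on \<Omega>)"
      unfolding r_def using correction_measurable[where X = X and \<epsilon> = \<epsilon> and \<omega> = \<omega>, OF \<Omega> basis \<omega> moments _ m]
      by blast
    show "AE y in lebesgue_on \<Omega>. norm (r m y * \<omega> y) \<le> norm (C * L y)"
      using dominated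
    proof eventually_elim
      case (elim y)
      have "\<bar>r m y * \<omega> y\<bar> \<le> (\<Sum>m<N. \<bar>r m y * \<omega> y\<bar>)"
        using m by (intro member_le_sum) auto
      with elim show ?case
        by simp
    qed
  qed
  have component: "weighted_integral \<Omega> \<omega> (aug_cardinal \<phi> p K \<epsilon> X N m) =
      weighted_integral \<Omega> \<omega> (pure_cardinal \<phi> \<epsilon> X N m) - (LINT y|lebesgue_on \<Omega>. r m y * \<omega> y)"
    if m: "m < N" for m
  proof -
    have "aug_cardinal \<phi> p K \<epsilon> X N m y * \<omega> y = pure_cardinal \<phi> \<epsilon> X N m y * \<omega> y - r m y * \<omega> y" for y
      using aug_cardinal_eq_pure_minus_correction(1)[OF det unique m]
      by (simp add: r_def left_diff_distrib)
    then show ?thesis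
      using pure_cardinal_integrable[where X = X and \<epsilon> = \<epsilon>, OF moments] r\<omega>[OF m]
      by (simp add: weighted_integral_def)
  qed
  have "\<bar>l1_norm (pure_weights \<Omega> \<omega> \<phi> \<epsilon> X N) - l1_norm (aug_weights \<Omega> \<omega> \<phi> p K \<epsilon> X N)\<bar>
      \<le> l1_norm (pure_weights \<Omega> \<omega> \<phi> \<epsilon> X N - aug_weights \<Omega> \<omega> \<phi> p K \<epsilon> X N)"
    by (rule l1_norm_diff_le) (simp add: pure_weights_def aug_weights_def)
  also have "\<dots> = (\<Sum>m<N. \<bar>LINT y|lebesgue_on \<Omega>. r m y * \<omega> y\<bar>)"
    by (simp add: l1_norm_def pure_weights_def aug_weights_def component)
  also have "\<dots> \<le> (\<Sum>m<N. (LINT y|lebesgue_on \<Omega>. \<bar>r m y * \<omega> y\<bar>))"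
    by (intro sum_mono integral_abs_bound)
  also have "\<dots> = (LINT y|lebesgue_on \<Omega>. (\<Sum>m<N. \<bar>r m y * \<omega> y\<bar>))"
    using r\<omega> by (intro Bochner_Integration.integral_sum[symmetric]) auto
  also have "\<dots> \<le> (LINT y|lebesgue_on \<Omega>. C * L y)"
    using r\<omega> CL dominated by (intro integral_mono_AE) auto
  finally show ?thesis
    by (simp add: L_def)
qed


section \<open>Equivalence of asymptotic stability\<close>


theorem theorem6p1:
  fixes \<Omega> :: "(real ^ 'D) set"
    and \<omega> :: "real ^ 'D \<Rightarrow> real"
    and d K :: nat
    and p :: "nat \<Rightarrow> real ^ 'D \<Rightarrow> real"
    and \<phi> :: "real \<Rightarrow> real"
    and X :: "nat \<Rightarrow> nat \<Rightarrow> real ^ 'D"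
    and \<epsilon> :: "nat \<Rightarrow> nat \<Rightarrow> real"
  assumes domain: "\<Omega> \<in> sets lebesgue" "bounded \<Omega>" "measure lebesgue \<Omega> > 0"
    and weight: "L_infinity \<Omega> \<omega>"
    and basis: "poly_basis_on \<Omega> d K p"
    and points: "\<And>N n. n < N \<Longrightarrow> X N n \<in> \<Omega>" "\<And>N. inj_on (X N) {..<N}"
    and shapes: "\<And>N n. n < N \<Longrightarrow> \<epsilon> N n \<ge> 0"
    and moments: "\<And>N n. n < N \<Longrightarrow>
      integrable (lebesgue_on \<Omega>) (\<lambda>y. \<phi> (\<epsilon> N n * norm (y - X N n)) * \<omega> y)"
    and full_rank_Phi: "\<forall>\<^sub>F N in sequentially. vec_space.rank N (rbf_mat \<phi> (\<epsilon> N) (X N) N) = N"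
    and full_rank_P: "\<forall>\<^sub>F N in sequentially. vec_space.rank N (poly_mat p K (X N) N) = K"
    and well_posed: "\<forall>\<^sub>F N in sequentially.
      \<forall>m<N. \<exists>!s. s \<in> aug_coeffs \<phi> p K (\<epsilon> N) (X N) N m"
    and B_tau: "tends_to_0_in_L1 \<Omega>
      (\<lambda>N y. l1_norm (B_mat \<phi> p K (\<epsilon> N) (X N) N *\<^sub>v tau \<phi> p K (\<epsilon> N) (X N) N y))"
  shows "asymptotically_stable \<Omega> \<omega> (\<lambda>N. pure_weights \<Omega> \<omega> \<phi> (\<epsilon> N) (X N) N) \<longleftrightarrow>
         asymptotically_stable \<Omega> \<omega> (\<lambda>N. aug_weights \<Omega> \<omega> \<phi> p K (\<epsilon> N) (X N) N)"
proof -
  define L where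
    "L N y = l1_norm (B_mat \<phi> p K (\<epsilon> N) (X N) N *\<^sub>v tau \<phi> p K (\<epsilon> N) (X N) N y)" for N y
  have L_nonneg: "\<bar>L N y\<bar> = L N y" for N y
    by (simp add: L_def l1_norm_def sum_nonneg)
  define u where "u N = l1_norm (pure_weights \<Omega> \<omega> \<phi> (\<epsilon> N) (X N) N)" for N
  define v where "v N = l1_norm (aug_weights \<Omega> \<omega> \<phi> p K (\<epsilon> N) (X N) N)" for N
  obtain C where \<omega>: "\<omega> \<in> borel_measurable (lebesgue_on \<Omega>)"
    and bound: "AE y in lebesgue_on \<Omega>. \<bar>\<omega> y\<bar> \<le> C"
    using weight by (auto simp: L_infinity_def)
  have integrable: "\<forall>\<^sub>F N in sequentially. integrable (lebesgue_on \<Omega>) (L N)"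
    and L_lim: "(\<lambda>N. LINT y|lebesgue_on \<Omega>. L N y) \<longlonglongrightarrow> 0"
    using B_tau L_nonneg by (simp_all add: tends_to_0_in_L1_def L_def[symmetric])
  have "\<forall>\<^sub>F N in sequentially. norm (u N - v N) \<le> C * (LINT y|lebesgue_on \<Omega>. L N y)"
    using integrable full_rank_Phi well_posed
  proof eventually_elim
    case (elim N)
    have "rbf_mat \<phi> (\<epsilon> N) (X N) N \<in> carrier_mat N N"
      by (simp add: rbf_mat_def)
    then have "Determinant.det ((rbf_mat \<phi> (\<epsilon> N) (X N) N)\<^sup>T) \<noteq> 0"
      using elim(2) vec_space.det_rank_iff det_transpose by metis
    then show ?case
      using weights_distance_le[where X = "X N" and \<epsilon> = "\<epsilon> N" and N = N,
          OF domain(1) basis \<omega> bound moments] elim(1,3)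
      by (simp add: u_def v_def L_def[abs_def])
  qed
  moreover have "(\<lambda>N. C * (LINT y|lebesgue_on \<Omega>. L N y)) \<longlonglongrightarrow> 0"
    using tendsto_mult_right_zero[OF L_lim] .
  ultimately have diff: "(\<lambda>N. u N - v N) \<longlonglongrightarrow> 0"
    by (rule Lim_null_comparison)
  have "u \<longlonglongrightarrow> l \<longleftrightarrow> v \<longlonglongrightarrow> l" for l
    using Lim_transform[OF _ diff] Lim_transform2[OF _ diff] by blast
  then show ?thesis
    by (simp add: asymptotically_stable_def u_def[abs_def] v_def[abs_def])
qed

end
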